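(* A collection $B$ of patterns has a limit sequence if and only if $B$ contains a pattern $p$ such that $\mathrm{inv}(p)\le 1$.
   Context: A pattern is a (nonempty) permutation. A permutation $\pi$ contains a pattern $p$ if $\pi$ has a subsequence order-isomorphic to $p$; otherwise it avoids $p$. $\mathrm{inv}(\pi)$ is the number of inversions of $\pi$, i.e. pairs $i<j$ with $\pi_i>\pi_j$. $\mathrm{av}_n^k(B)$ is the number of permutations in $S_n$ with exactly $k$ inversions avoiding every pattern in $B$. $B$ has a limit sequence if for every $k\ge 0$ there exist constants $m_k$ and $c_k$ such that $\mathrm{av}_n^k(B)=c_k$ for all $n\ge m_k$. *)

theory Defs
  imports "HOL-Combinatorics.Multiset_Permutations" "HOL-Library.Sublist"
begin

text \<open>
  Permutations of size \<open>n\<close> are lists in one-line notation, i.e. elements of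
  \<^term>\<open>permutations_of_set {1..n}\<close>; list positions are counted from 0, values from 1.
\<close>

definition perms :: "nat \<Rightarrow> nat list set" where
  "perms n = permutations_of_set {1..n}"

definition is_pattern :: "nat list \<Rightarrow> bool" where
  "is_pattern p \<longleftrightarrow> (\<exists>n\<ge>1. p \<in> perms n)"

definition inv_count :: "nat list \<Rightarrow> nat" where
  "inv_count \<pi> = card {(i, j). i < j \<and> j < length \<pi> \<and> \<pi> ! i > \<pi> ! j}"

definition order_isomorphic :: "nat list \<Rightarrow> nat list \<Rightarrow> bool" where
  "order_isomorphic xs ys \<longleftrightarrow> length xs = length ys \<and>
     (\<forall>i<length xs. \<forall>j<length xs. xs ! i < xs ! j \<longleftrightarrow> ys ! i < ys ! j)"

definition contains_pattern :: "nat list \<Rightarrow> nat list \<Rightarrow> bool" where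
  "contains_pattern \<pi> p \<longleftrightarrow> (\<exists>xs. subseq xs \<pi> \<and> order_isomorphic xs p)"

definition avoids :: "nat list \<Rightarrow> nat list \<Rightarrow> bool" where
  "avoids \<pi> p \<longleftrightarrow> \<not> contains_pattern \<pi> p"

definition av :: "nat \<Rightarrow> nat \<Rightarrow> nat list set \<Rightarrow> nat" where
  "av n k B = card {\<pi> \<in> perms n. inv_count \<pi> = k \<and> (\<forall>p\<in>B. avoids \<pi> p)}"

definition has_limit_sequence :: "nat list set \<Rightarrow> bool" where
  "has_limit_sequence B \<longleftrightarrow> (\<forall>k. \<exists>m c. \<forall>n\<ge>m. av n k B = c)"

end

theory Submission
  imports Defs
begin

text \<open>
  If no pattern of \<open>B\<close> has at most one inversion, then every permutation with a single inversion
  avoids \<open>B\<close>, so \<open>av n 1 B \<ge> n - 1\<close> is unbounded.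

  Conversely let \<open>p \<in> B\<close> have at most one inversion. In a long permutation with \<open>k\<close> inversions all
  but \<open>2 * k\<close> positions take part in no inversion, and the two ends of an inversion are at distance
  at most \<open>k\<close>. An inversion far from both ends of the permutation could therefore be completed to an
  occurrence of \<open>p\<close>. Hence in an avoider a fixed position \<open>c\<close> is in no inversion, its entry is a
  fixed point that splits the permutation as a direct sum, and deleting it is injective. So
  \<open>av n k B\<close> is eventually weakly decreasing in \<open>n\<close>, hence eventually constant.
\<close>

section \<open>Inversions\<close>

definition inversions :: "nat list \<Rightarrow> (nat \<times> nat) set" where
  "inversions w = {(i, j). i < j \<and> j < length w \<and> w ! i > w ! j}"

lemma inv_count_eq: "inv_count w = card (inversions w)"
  by (simp add: inv_count_def inversions_def)

lemma finite_inversions [simp]: "finite (inversions w)"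
  by (rule finite_subset[of _ "{..<length w} \<times> {..<length w}"]) (auto simp: inversions_def)

lemma inv_count_Nil [simp]: "inv_count [] = 0"
  by (simp add: inv_count_def)

text \<open>Pairs are sorted by whether their left index is 0. The resulting recursion makes list
  induction available.\<close>

lemma inv_count_Cons [simp]:
  "inv_count (x # xs) = length (filter (\<lambda>y. y < x) xs) + inv_count xs"
proof -
  let ?S = "{j. j < length xs \<and> xs ! j < x}"
  have split: "inversions (x # xs) = (\<lambda>j. (0::nat, Suc j)) ` ?S \<union> map_prod Suc Suc ` inversions xs"
    (is "?L = ?R")
  proof (intro equalityI subsetI)
    fix q assume "q \<in> ?L"
    then obtain i j where q: "q = (i, Suc j)" "i < Suc j" "j < length xs" "(x # xs) ! i > xs ! j"
      by (auto simp: inversions_def gr0_conv_Suc less_Suc_eq_0_disj)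
    then show "q \<in> ?R"
      by (cases i) (auto simp: inversions_def image_iff map_prod_def)
  qed (auto simp: inversions_def)
  have "card (inversions (x # xs))
      = card ((\<lambda>j. (0::nat, Suc j)) ` ?S) + card (map_prod Suc Suc ` inversions xs)"
    unfolding split by (rule card_Un_disjoint) auto
  also have "card ((\<lambda>j. (0::nat, Suc j)) ` ?S) = card ?S"
    by (rule card_image) (auto simp: inj_on_def)
  also have "card (map_prod Suc Suc ` inversions xs) = card (inversions xs)"
    by (rule card_image) (auto simp: inj_on_def)
  finally show ?thesis
    by (simp add: inv_count_eq length_filter_conv_card)
qed

lemma inv_count_append:
  "inv_count (xs @ ys)
    = inv_count xs + inv_count ys + (\<Sum>x\<leftarrow>xs. length (filter (\<lambda>y. y < x) ys))"
  by (induction xs) auto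

lemma inv_count_append_less:
  assumes "\<And>x y. x \<in> set xs \<Longrightarrow> y \<in> set ys \<Longrightarrow> x < y"
  shows "inv_count (xs @ ys) = inv_count xs + inv_count ys"
proof -
  have "filter (\<lambda>y. y < x) ys = []" if "x \<in> set xs" for x
    using assms[OF that] by (auto simp: filter_empty_conv dest: order.asym)
  then have "(\<Sum>x\<leftarrow>xs. length (filter (\<lambda>y. y < x) ys)) = 0"
    by (simp add: sum_list_eq_0_iff)
  then show ?thesis by (simp add: inv_count_append)
qed

lemma inv_count_strict_sorted: "sorted_wrt (<) w \<Longrightarrow> inv_count w = 0"
  by (induction w) (auto simp: filter_empty_conv dest: order.asym)

lemma subseq_filter_length_le:
  "subseq xs ys \<Longrightarrow> length (filter P xs) \<le> length (filter P ys)"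
  by (intro list_emb_length[of "(=)"] subseq_filter)

lemma inv_count_subseq: "subseq xs ys \<Longrightarrow> inv_count xs \<le> inv_count ys"
proof (induction rule: list_emb.induct)
  case (list_emb_Cons2 x y xs ys)
  then show ?case
    using subseq_filter_length_le[OF list_emb_Cons2.hyps(2), of "\<lambda>z. z < x"] by simp
qed auto

lemma inv_count_order_isomorphic: "order_isomorphic xs ys \<Longrightarrow> inv_count xs = inv_count ys"
  unfolding inv_count_def order_isomorphic_def
  by (rule arg_cong[of _ _ card]) auto

text \<open>An occurrence keeps all inversions of \<open>p\<close>, so permutations with one
  inversion avoid every pattern with two or more.\<close>

lemma inv_count_contains: "contains_pattern w p \<Longrightarrow> inv_count p \<le> inv_count w"
  unfolding contains_pattern_def
  using inv_count_subseq inv_count_order_isomorphic by fastforce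

text \<open>Every position strictly between \<open>i\<close> and \<open>j\<close> forms an inversion with \<open>i\<close> or with \<open>j\<close>.\<close>

lemma inversion_distance:
  assumes "(i, j) \<in> inversions w"
  shows "j - i \<le> inv_count w"
proof -
  have ij: "i < j" "j < length w" "w ! i > w ! j"
    using assms by (auto simp: inversions_def)
  \<comment> \<open>\<open>x = j\<close> yields \<open>(i, j)\<close> itself. The two forms never
    collide, since \<open>x > i\<close>, so the \<open>j - i\<close> positions give distinct
    inversions.\<close>
  let ?f = "\<lambda>x. if w ! x < w ! i then (i, x) else (x, j)"
  have "card (?f ` {i<..j}) = card {i<..j}"
    by (rule card_image) (auto simp: inj_on_def split: if_splits)
  moreover have "?f ` {i<..j} \<subseteq> inversions w"
  proof
    fix q assume "q \<in> ?f ` {i<..j}"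
    then obtain x where x: "i < x" "x \<le> j" "q = ?f x" by auto
    show "q \<in> inversions w"
    proof (cases "w ! x < w ! i")
      case False
      then have "x \<noteq> j" using ij by auto
      then show ?thesis using x ij False by (auto simp: inversions_def)
    qed (use x ij in \<open>auto simp: inversions_def\<close>)
  qed
  ultimately show ?thesis
    using card_mono[OF finite_inversions, of "?f ` {i<..j}" w] by (simp add: inv_count_eq)
qed

section \<open>Positions that take part in no inversion\<close>

definition quiet :: "nat list \<Rightarrow> nat set" where
  "quiet w = {..<length w} - (fst ` inversions w \<union> snd ` inversions w)"

lemma quietD:
  assumes "x \<in> quiet w"
  shows "(x, y) \<notin> inversions w" "(y, x) \<notin> inversions w"
  using assms by (force simp: quiet_def)+

lemma quiet_subset: "quiet w \<subseteq> {..<length w}"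
  by (auto simp: quiet_def)

text \<open>Each inversion spoils at most its two end positions.\<close>

lemma card_Int_quiet:
  assumes "S \<subseteq> {..<length w}"
  shows "card S \<le> card (S \<inter> quiet w) + 2 * inv_count w"
proof -
  let ?N = "fst ` inversions w \<union> snd ` inversions w"
  have "finite S" using assms finite_subset by blast
  have "card ?N \<le> card (fst ` inversions w) + card (snd ` inversions w)"
    by (rule card_Un_le)
  also have "\<dots> \<le> 2 * inv_count w"
    using card_image_le[of "inversions w" fst] card_image_le[of "inversions w" snd]
    by (simp add: inv_count_eq)
  finally have N: "card ?N \<le> 2 * inv_count w" .
  have "card S \<le> card ((S \<inter> quiet w) \<union> ?N)"
    using assms \<open>finite S\<close> by (intro card_mono) (auto simp: quiet_def)
  also have "\<dots> \<le> card (S \<inter> quiet w) + card ?N"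
    by (rule card_Un_le)
  finally show ?thesis using N by linarith
qed

lemma subset_quiet:
  assumes "S \<subseteq> {..<length w}" "m + 2 * inv_count w \<le> card S"
  obtains A where "A \<subseteq> S" "A \<subseteq> quiet w" "finite A" "card A = m"
proof -
  have "m \<le> card (S \<inter> quiet w)"
    using card_Int_quiet[OF assms(1)] assms(2) by linarith
  then obtain A where "A \<subseteq> S \<inter> quiet w" "card A = m" "finite A"
    by (rule obtain_subset_with_card_n)
  then show thesis using that by blast
qed

section \<open>Occurrences of patterns with at most one inversion\<close>

lemma perms_iff: "w \<in> perms n \<longleftrightarrow> distinct w \<and> set w = {1..n}"
  by (auto simp: perms_def permutations_of_set_def)

lemma length_perms: "w \<in> perms n \<Longrightarrow> length w = n"
  using distinct_card[of w] by (simp add: perms_iff)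

lemma subseq_map_nth:
  assumes "sorted_wrt (<) ns" "set ns \<subseteq> {..<length w}"
  shows "subseq (map ((!) w) ns) w"
proof -
  \<comment> \<open>A strictly increasing index list is determined by its set, so filtering all
    indices recovers it.\<close>
  have "filter (\<lambda>x. x \<in> set ns) [0..<length w] = ns"
    using assms by (intro sorted_distinct_set_unique)
      (auto simp: strict_sorted_iff sorted_wrt_filter)
  then have "subseq ns [0..<length w]"
    by (metis subseq_filter_left)
  then have "subseq (map ((!) w) ns) (map ((!) w) [0..<length w])"
    by (rule subseq_map)
  then show ?thesis by (simp add: map_nth)
qed

text \<open>An occurrence is given by its list of positions. Entries are distinct, so pairs that are
  not inversions are ascents, and matching inversions fixes the whole relative order.\<close>

lemma contains_patternI:
  assumes ns: "sorted_wrt (<) ns" "set ns \<subseteq> {..<length w}"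
    and len: "length ns = length p"
    and dist: "distinct w" "distinct p"
    and inv: "\<And>x y. x < y \<Longrightarrow> y < length p \<Longrightarrow> (ns ! x, ns ! y) \<in> inversions w \<longleftrightarrow> (x, y) \<in> inversions p"
  shows "contains_pattern w p"
proof -
  have lt: "ns ! x < length w" if "x < length p" for x
    using ns(2) len that by (metis lessThan_iff nth_mem subsetD)
  have mono: "ns ! x < ns ! y" if "x < y" "y < length p" for x y
    using ns(1) len that by (simp add: sorted_wrt_nth_less)
  have gt: "w ! (ns ! x) > w ! (ns ! y) \<longleftrightarrow> p ! x > p ! y" if "x < y" "y < length p" for x y
    using inv[OF that] lt[OF that(2)] mono[OF that] that by (simp add: inversions_def)
  have ne: "w ! (ns ! x) \<noteq> w ! (ns ! y)" "p ! x \<noteq> p ! y" if "x < y" "y < length p" for x y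
    using lt[of x] lt[OF that(2)] mono[OF that] that dist by (auto simp: nth_eq_iff_index_eq)
  have "w ! (ns ! x) < w ! (ns ! y) \<longleftrightarrow> p ! x < p ! y" if "x < length p" "y < length p" for x y
  proof (cases x y rule: linorder_cases)
    case less
    then show ?thesis using gt[OF less that(2)] ne[OF less that(2)] by linarith
  next
    case greater
    then show ?thesis using gt[OF greater that(1)] by simp
  qed simp
  then have "order_isomorphic (map ((!) w) ns) p"
    by (simp add: order_isomorphic_def len)
  then show ?thesis
    using subseq_map_nth[OF ns] by (auto simp: contains_pattern_def)
qed

text \<open>Here \<open>p\<close> is increasing, and so are the entries at any quiet positions; at
  most \<open>2 * inv_count w\<close> positions are not quiet.\<close>

lemma contains_no_inversion:
  assumes dist: "distinct w" "distinct p" and p: "inv_count p = 0"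
    and len: "length p + 2 * inv_count w \<le> length w"
  shows "contains_pattern w p"
proof -
  obtain A where A: "A \<subseteq> quiet w" "finite A" "card A = length p"
    by (rule subset_quiet[of "{..<length w}" w "length p"]) (use len in simp_all)
  let ?ns = "sorted_list_of_set A"
  show ?thesis
  proof (rule contains_patternI[of ?ns])
    fix x y assume xy: "x < y" "y < length p"
    have "?ns ! x \<in> A"
      using A xy nth_mem[of x ?ns] by simp
    then have "?ns ! x \<in> quiet w" using A by blast
    moreover have "inversions p = {}" using p by (simp add: inv_count_eq)
    ultimately show "(?ns ! x, ?ns ! y) \<in> inversions w \<longleftrightarrow> (x, y) \<in> inversions p"
      using quietD(1) by simp
  next
    show "set ?ns \<subseteq> {..<length w}" using A quiet_subset[of w] by auto
  qed (use A dist in auto)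
qed

text \<open>The only inversion of \<open>p\<close> is played by \<open>(i, j)\<close>; its other
  entries are played by quiet positions to the left of \<open>i\<close> and to the right of
  \<open>j\<close>, where the margins leave enough of them.\<close>

lemma contains_one_inversion:
  assumes dist: "distinct w" "distinct p" and p: "inv_count p = 1"
    and ij: "(i, j) \<in> inversions w"
    and left: "length p + 2 * inv_count w \<le> i"
    and right: "j + 1 + length p + 2 * inv_count w \<le> length w"
  shows "contains_pattern w p"
proof -
  from p obtain s t where st: "inversions p = {(s, t)}"
    unfolding inv_count_eq by (metis card_1_singletonE surj_pair)
  then have "s < t" "t < length p" by (auto simp: inversions_def)
  \<comment> \<open>A lone inversion joins neighbouring positions, so no entry of \<open>p\<close>
    has to be placed between \<open>i\<close> and \<open>j\<close>.\<close>
  moreover have "t - s \<le> 1" using inversion_distance[of s t p] st p by simp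
  ultimately have t: "t = Suc s" "Suc s < length p" by auto
  have ij': "i < j" "j < length w" using ij by (auto simp: inversions_def)
  have "{..<i} \<subseteq> {..<length w}" "s + 2 * inv_count w \<le> card {..<i}"
    using left ij' t by auto
  then obtain A where A: "A \<subseteq> {..<i}" "A \<subseteq> quiet w" "finite A" "card A = s"
    by (rule subset_quiet)
  have "{j<..<length w} \<subseteq> {..<length w}"
    "length p - s - 2 + 2 * inv_count w \<le> card {j<..<length w}"
    using right by auto
  then obtain C where C: "C \<subseteq> {j<..<length w}" "C \<subseteq> quiet w" "finite C" "card C = length p - s - 2"
    by (rule subset_quiet)
  let ?a = "sorted_list_of_set A" and ?c = "sorted_list_of_set C"
  let ?ns = "?a @ i # j # ?c"
  have len: "length ?ns = length p" using A C t by simp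
  have quiet: "?ns ! x \<in> quiet w" if "x < length p" "x \<noteq> s" "x \<noteq> Suc s" for x
  proof (cases "x < s")
    case True
    then have "?ns ! x = ?a ! x" using A by (simp add: nth_append)
    moreover have "?a ! x \<in> A" using True A nth_mem[of x ?a] by simp
    ultimately show ?thesis using A by auto
  next
    case False
    then have "s + 2 \<le> x" using that by simp
    then obtain d where d: "x = s + 2 + d" by (metis le_Suc_ex)
    have "?ns ! x = ?c ! d" unfolding d using A by (simp add: nth_append)
    moreover have "d < length ?c" using d that(1) C by simp
    then have "?c ! d \<in> C" using C nth_mem[of d ?c] by simp
    ultimately show ?thesis using C by auto
  qed
  have s: "?ns ! s = i" "?ns ! Suc s = j" using A by (simp_all add: nth_append)
  show ?thesis
  proof (rule contains_patternI[of ?ns])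
    fix x y assume xy: "x < y" "y < length p"
    show "(?ns ! x, ?ns ! y) \<in> inversions w \<longleftrightarrow> (x, y) \<in> inversions p"
    proof (cases "x = s \<and> y = Suc s")
      case True
      then show ?thesis using s ij st t by simp
    next
      case False
      \<comment> \<open>Any other pair has an index outside \<open>s\<close>, \<open>Suc s\<close>,
        which is sent to a quiet position.\<close>
      then have "(x \<noteq> s \<and> x \<noteq> Suc s) \<or> (y \<noteq> s \<and> y \<noteq> Suc s)" using xy by auto
      then have "(?ns ! x, ?ns ! y) \<notin> inversions w"
        using quiet[of x] quiet[of y] xy quietD by (meson less_trans)
      then show ?thesis using st t False by auto
    qed
  next
    show "sorted_wrt (<) ?ns"
      using A C ij' by (fastforce simp: sorted_wrt_append)
  next
    show "set ?ns \<subseteq> {..<length w}"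
      using A C ij' by fastforce
  qed (use len dist in auto)
qed

text \<open>An inversion ending at \<open>c\<close> stays within \<open>inv_count w\<close> of
  \<open>c\<close>. A margin of \<open>3 * inv_count w\<close> on each side thus still leaves the
  \<open>2 * inv_count w\<close> needed to complete an occurrence of \<open>p\<close>.\<close>

lemma avoider_quiet:
  assumes dist: "distinct w" "distinct p" and p: "inv_count p \<le> 1"
    and avoid: "avoids w p"
    and c: "c = length p + 3 * inv_count w"
    and len: "c + 1 + length p + 3 * inv_count w \<le> length w"
  shows "c \<in> quiet w"
proof (rule ccontr)
  assume "c \<notin> quiet w"
  then obtain i j where ij: "(i, j) \<in> inversions w" "c = i \<or> c = j"
    using len by (force simp: quiet_def)
  have "i < j" using ij by (auto simp: inversions_def)
  then have bounds: "c \<le> i + inv_count w" "j \<le> c + inv_count w"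
    using inversion_distance[OF ij(1)] ij(2) by linarith+
  have "contains_pattern w p"
  proof (cases "inv_count p = 0")
    case True
    then show ?thesis using contains_no_inversion dist len by simp
  next
    case False
    then show ?thesis
      using contains_one_inversion[OF dist _ ij(1)] p bounds c len by simp
  qed
  then show False using avoid by (simp add: avoids_def)
qed

section \<open>Deleting a fixed point that takes part in no inversion\<close>

text \<open>A quiet position exceeds all earlier entries and is below all later ones (a strong fixed
  point). The value is \<open>Suc c\<close> because positions start at 0 and values at 1.\<close>

lemma quiet_split:
  assumes w: "w \<in> perms n" and c: "c \<in> quiet w"
  shows "w = take c w @ Suc c # drop (Suc c) w"
    and "set (take c w) = {1..c}" and "set (drop (Suc c) w) = {Suc (Suc c)..n}"
proof -
  have dist: "distinct w" and set: "set w = {1..n}" using w by (auto simp: perms_iff)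
  have cn: "c < length w" using c by (auto simp: quiet_def)
  let ?A = "take c w" and ?C = "drop (Suc c) w" and ?v = "w ! c"
  have split: "w = ?A @ ?v # ?C" using cn by (rule id_take_nth_drop)
  have lessA: "x < ?v" if x: "x \<in> set ?A" for x
  proof -
    obtain i where i: "i < c" "x = w ! i" using x cn by (auto simp: in_set_conv_nth)
    have "w ! i \<noteq> ?v" using i cn dist by (simp add: nth_eq_iff_index_eq)
    moreover have "\<not> w ! i > ?v" using quietD(2)[OF c, of i] i cn by (auto simp: inversions_def)
    ultimately show ?thesis using i by simp
  qed
  have lessC: "?v < x" if x: "x \<in> set ?C" for x
  proof -
    obtain d where "d < length ?C" "x = ?C ! d" using x by (metis in_set_conv_nth)
    then have d: "Suc c + d < length w" "x = w ! (Suc c + d)" by simp_all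
    have "w ! (Suc c + d) \<noteq> ?v" using d cn dist by (simp add: nth_eq_iff_index_eq)
    moreover have "\<not> w ! (Suc c + d) < ?v"
      using quietD(1)[OF c, of "Suc c + d"] d cn by (auto simp: inversions_def)
    ultimately show ?thesis using d by simp
  qed
  have "set w = set ?A \<union> {?v} \<union> set ?C"
    using arg_cong[OF split, of set] by (simp only: set_append list.set) blast
  then have mem: "x \<in> set ?A \<or> x = ?v \<or> x \<in> set ?C \<longleftrightarrow> 1 \<le> x \<and> x \<le> n" for x
    unfolding set by (metis Un_iff atLeastAtMost_iff singleton_iff)
  have "x \<in> set ?A \<longleftrightarrow> 1 \<le> x \<and> x < ?v" for x
    using mem[of x] mem[of ?v] lessA[of x] lessC[of x] by linarith
  then have A: "set ?A = {1..<?v}" by (simp only: set_eq_iff atLeastLessThan_iff simp_thms)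
  \<comment> \<open>The prefix consists of all values below \<open>?v\<close> and has length
    \<open>c\<close>, which determines \<open>?v\<close>.\<close>
  have "?v - 1 = card (set ?A)" unfolding A by simp
  also have "\<dots> = c" using dist cn by (subst distinct_card) auto
  finally have "?v - 1 = c" .
  moreover have "1 \<le> ?v" using mem[of ?v] by blast
  ultimately have v: "?v = Suc c" by simp
  show "w = ?A @ Suc c # ?C" using split unfolding v .
  show "set ?A = {1..c}" unfolding A v by (rule atLeastLessThanSuc_atLeastAtMost)
  have "x \<in> set ?C \<longleftrightarrow> Suc (Suc c) \<le> x \<and> x \<le> n" for x
    using mem[of x] lessA[of x] lessC[of x] v by linarith
  then show "set ?C = {Suc (Suc c)..n}"
    by (simp only: set_eq_iff atLeastAtMost_iff simp_thms)
qed

text \<open>Closes the gap left by removing the value \<open>Suc c\<close>. Order is preserved away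
  from that value, which itself collides with \<open>c\<close>.\<close>

definition squeeze :: "nat \<Rightarrow> nat \<Rightarrow> nat" where
  "squeeze c x = (if x \<le> c then x else x - 1)"

definition delete_point :: "nat \<Rightarrow> nat list \<Rightarrow> nat list" where
  "delete_point c w = map (squeeze c) (take c w @ drop (Suc c) w)"

lemma squeeze_less_iff:
  assumes "x \<noteq> Suc c" "y \<noteq> Suc c"
  shows "squeeze c x < squeeze c y \<longleftrightarrow> x < y"
  using assms by (auto simp: squeeze_def)

lemma inj_on_squeeze: "inj_on (squeeze c) (- {Suc c})"
  by (auto simp: inj_on_def squeeze_def split: if_splits)

lemma order_isomorphic_squeeze:
  assumes "Suc c \<notin> set xs"
  shows "order_isomorphic xs (map (squeeze c) xs)"
proof -
  have "xs ! i \<noteq> Suc c" if "i < length xs" for i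
    using assms that nth_mem by metis
  then show ?thesis by (auto simp: order_isomorphic_def squeeze_less_iff)
qed

lemma order_isomorphic_trans:
  assumes "order_isomorphic xs ys" "order_isomorphic ys zs"
  shows "order_isomorphic xs zs"
  unfolding order_isomorphic_def
proof (intro conjI allI impI)
  have len: "length xs = length ys" "length ys = length zs"
    using assms unfolding order_isomorphic_def by blast+
  then show "length xs = length zs" by (rule trans)
  fix i j assume ij: "i < length xs" "j < length xs"
  then have "xs ! i < xs ! j \<longleftrightarrow> ys ! i < ys ! j"
    using assms(1) unfolding order_isomorphic_def by blast
  also have "\<dots> \<longleftrightarrow> zs ! i < zs ! j"
    using assms(2) ij[unfolded len(1)] unfolding order_isomorphic_def by blast
  finally show "xs ! i < xs ! j \<longleftrightarrow> zs ! i < zs ! j" .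
qed

context
  fixes w n c
  assumes w: "w \<in> perms (Suc n)" and c: "c \<in> quiet w"
begin

lemma rest_not_mem: "Suc c \<notin> set (take c w @ drop (Suc c) w)"
  using quiet_split(2,3)[OF w c] by simp

lemma delete_point_perms: "delete_point c w \<in> perms n"
proof -
  have cn: "c < Suc n" using c length_perms[OF w] by (auto simp: quiet_def)
  let ?r = "take c w @ drop (Suc c) w"
  have "distinct (take c w @ Suc c # drop (Suc c) w)"
    using w by (simp only: quiet_split(1)[OF w c, symmetric] perms_iff)
  then have "distinct ?r" by simp
  moreover have "inj_on (squeeze c) (set ?r)"
    using rest_not_mem by (intro inj_on_subset[OF inj_on_squeeze]) blast
  ultimately have "distinct (delete_point c w)"
    unfolding delete_point_def by (simp only: distinct_map simp_thms)
  moreover have "set (delete_point c w) = squeeze c ` {1..c} \<union> squeeze c ` {Suc (Suc c)..Suc n}"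
    using quiet_split(2,3)[OF w c] by (simp add: delete_point_def image_Un)
  moreover have "squeeze c ` {1..c} = {1..c}"
    by (auto simp: squeeze_def)
  moreover have "squeeze c ` {Suc (Suc c)..Suc n} = {Suc c..n}"
  proof -
    have "squeeze c ` {Suc (Suc c)..Suc n} = squeeze c ` Suc ` {Suc c..n}"
      by (simp only: image_Suc_atLeastAtMost)
    also have "\<dots> = {Suc c..n}"
      unfolding image_image by (auto simp: squeeze_def)
    finally show ?thesis .
  qed
  ultimately show ?thesis using cn by (auto simp: perms_iff)
qed

text \<open>The deleted point is in no inversion, and no inversion crosses from the entries before
  it to those after it, so the inversions inside the two blocks are all there are on both
  sides.\<close>

lemma inv_count_delete_point: "inv_count (delete_point c w) = inv_count w"
proof -
  note qs = quiet_split[OF w c]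
  let ?A = "take c w" and ?C = "drop (Suc c) w"
  have "filter (\<lambda>y. y < Suc c) ?C = []" using qs(3) by (auto simp: filter_empty_conv)
  then have C: "inv_count (Suc c # ?C) = inv_count ?C"
    by (simp only: inv_count_Cons list.size add_0)
  have "inv_count w = inv_count (?A @ Suc c # ?C)" by (rule arg_cong[OF qs(1)])
  also have "\<dots> = inv_count ?A + inv_count (Suc c # ?C)"
    using qs(2,3) by (intro inv_count_append_less) auto
  also have "\<dots> = inv_count (?A @ ?C)"
    unfolding C using qs(2,3) by (intro inv_count_append_less[symmetric]) auto
  also have "\<dots> = inv_count (delete_point c w)"
    unfolding delete_point_def
    by (rule inv_count_order_isomorphic[OF order_isomorphic_squeeze[OF rest_not_mem]])
  finally show ?thesis ..
qed

text \<open>Squeezing preserves relative order, so an occurrence lifts back to \<open>w\<close>;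
  hence deletion preserves avoidance.\<close>

lemma contains_delete_point:
  assumes "contains_pattern (delete_point c w) p"
  shows "contains_pattern w p"
proof -
  let ?r = "take c w @ drop (Suc c) w"
  obtain ys where ys: "subseq ys (map (squeeze c) ?r)" "order_isomorphic ys p"
    using assms unfolding contains_pattern_def delete_point_def by blast
  \<comment> \<open>Selecting by an index set commutes with \<open>map\<close>, which pulls the
    occurrence back through \<open>squeeze\<close>.\<close>
  obtain N where "ys = nths (map (squeeze c) ?r) N"
    using ys(1) unfolding subseq_conv_nths by blast
  then have "ys = map (squeeze c) (nths ?r N)" by (simp only: nths_map)
  then have "order_isomorphic (nths ?r N) ys"
    by (simp only: order_isomorphic_squeeze[OF notin_set_nthsI[OF rest_not_mem]])
  then have "order_isomorphic (nths ?r N) p"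
    by (rule order_isomorphic_trans) (rule ys(2))
  moreover have "subseq (nths ?r N) w"
  proof (rule subseq_order.trans)
    show "subseq (nths ?r N) ?r" unfolding subseq_conv_nths by blast
    have "subseq ?r (take c w @ Suc c # drop (Suc c) w)"
      by (intro list_emb_append_mono list_emb_Cons subseq_order.order_refl)
    then show "subseq ?r w" by (simp only: quiet_split(1)[OF w c, symmetric])
  qed
  ultimately show ?thesis unfolding contains_pattern_def by blast
qed

end

text \<open>The lost entry is known to be \<open>Suc c\<close> at position \<open>c\<close>, and
  \<open>squeeze c\<close> is injective on the remaining entries, so the permutation can be
  rebuilt.\<close>

lemma delete_point_inj:
  assumes v: "v \<in> perms (Suc n)" "c \<in> quiet v" and w: "w \<in> perms (Suc n)" "c \<in> quiet w"
    and eq: "delete_point c v = delete_point c w"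
  shows "v = w"
proof -
  have "take c v @ drop (Suc c) v = take c w @ drop (Suc c) w"
    (is "?v = ?w")
  proof (rule map_inj_on)
    show "map (squeeze c) ?v = map (squeeze c) ?w" using eq by (simp only: delete_point_def)
    show "inj_on (squeeze c) (set ?v \<union> set ?w)"
      using rest_not_mem[OF v] rest_not_mem[OF w] by (intro inj_on_subset[OF inj_on_squeeze]) blast
  qed
  moreover have "length (take c v) = length (take c w)"
    using length_perms[OF v(1)] length_perms[OF w(1)] by simp
  ultimately have "take c v = take c w" "drop (Suc c) v = drop (Suc c) w"
    by simp_all
  then have "take c v @ Suc c # drop (Suc c) v = take c w @ Suc c # drop (Suc c) w"
    by simp
  then show ?thesis
    by (simp only: quiet_split(1)[OF v, symmetric] quiet_split(1)[OF w, symmetric])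
qed

section \<open>Limit sequences\<close>

lemma finite_perms [simp]: "finite (perms n)"
  by (simp add: perms_def)

lemma av_Suc_le:
  assumes p: "p \<in> B" "distinct p" "inv_count p \<le> 1"
    and n: "2 * length p + 6 * k \<le> n"
  shows "av (Suc n) k B \<le> av n k B"
proof -
  let ?S = "\<lambda>n. {w \<in> perms n. inv_count w = k \<and> (\<forall>p\<in>B. avoids w p)}"
  \<comment> \<open>This position depends only on \<open>p\<close> and \<open>k\<close>, so all
    avoiders are cut at the same place. The bound on \<open>n\<close> gives both margins:
    \<open>?c + 1 + length p + 3 * k <= Suc n\<close>.\<close>
  let ?c = "length p + 3 * k"
  have q: "?c \<in> quiet w" if "w \<in> ?S (Suc n)" for w
  proof (rule avoider_quiet)
    show "distinct w" using that by (simp add: perms_iff)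
    show "?c + 1 + length p + 3 * inv_count w \<le> length w"
      using that n length_perms[of w "Suc n"] by simp
  qed (use that p in auto)
  have "inj_on (delete_point ?c) (?S (Suc n))"
    by (intro inj_onI, rule delete_point_inj) (use q in auto)
  moreover have "delete_point ?c ` ?S (Suc n) \<subseteq> ?S n"
  proof safe
    fix w assume w: "w \<in> perms (Suc n)" "k = inv_count w" "\<forall>p\<in>B. avoids w p"
    then have c: "length p + 3 * inv_count w \<in> quiet w" using q[of w] by simp
    show "delete_point (length p + 3 * inv_count w) w \<in> perms n"
      by (rule delete_point_perms[OF w(1) c])
    show "inv_count (delete_point (length p + 3 * inv_count w) w) = inv_count w"
      by (rule inv_count_delete_point[OF w(1) c])
    fix r assume "r \<in> B"
    then show "avoids (delete_point (length p + 3 * inv_count w) w) r"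
      using w(3) contains_delete_point[OF w(1) c] by (auto simp: avoids_def)
  qed
  ultimately show ?thesis unfolding av_def by (intro card_inj_on_le) auto
qed

lemma nat_eventually_constant:
  fixes f :: "nat \<Rightarrow> nat"
  assumes "\<And>n. n \<ge> N \<Longrightarrow> f (Suc n) \<le> f n"
  shows "\<exists>m c. \<forall>n\<ge>m. f n = c"
proof -
  have mono: "f n \<le> f m" if "N \<le> m" "m \<le> n" for m n
    using that(2)
  proof (induction n rule: dec_induct)
    case (step k)
    then show ?case using assms[of k] that(1) by linarith
  qed simp
  \<comment> \<open>\<open>m\<close> is a place where \<open>f\<close> attains its minimum beyond
    \<open>N\<close>; from there a weakly decreasing \<open>f\<close> cannot move.\<close>
  obtain m where m: "m \<ge> N" "\<And>n. n \<ge> N \<Longrightarrow> f m \<le> f n"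
    using ex_has_least_nat[of "\<lambda>n. n \<ge> N" N f] by auto
  have "f n = f m" if "n \<ge> m" for n
    using mono[OF m(1) that] m(2)[of n] m(1) that by simp
  then show ?thesis by blast
qed

lemma has_limit_sequenceI:
  assumes "p \<in> B" "distinct p" "inv_count p \<le> 1"
  shows "has_limit_sequence B"
  unfolding has_limit_sequence_def
proof
  fix k
  show "\<exists>m c. \<forall>n\<ge>m. av n k B = c"
    by (rule nat_eventually_constant[where N = "2 * length p + 6 * k"]) (rule av_Suc_le[OF assms])
qed

section \<open>Adjacent transpositions as permutations with one inversion\<close>

definition adj_swap :: "nat \<Rightarrow> nat \<Rightarrow> nat list" where
  "adj_swap n i = [1..<i] @ Suc i # i # [Suc (Suc i)..<Suc n]"

lemma adj_swap_perms: "i \<in> {1..<n} \<Longrightarrow> adj_swap n i \<in> perms n"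
  by (auto simp: adj_swap_def perms_iff)

lemma inv_count_adj_swap: "inv_count (adj_swap n i) = 1"
proof -
  have "inv_count (adj_swap n i)
      = inv_count [1..<i] + inv_count (Suc i # i # [Suc (Suc i)..<Suc n])"
    unfolding adj_swap_def by (rule inv_count_append_less) auto
  moreover have "inv_count [1..<i] = 0" "inv_count [Suc (Suc i)..<Suc n] = 0"
    by (rule inv_count_strict_sorted, rule sorted_wrt_upt)+
  moreover have "filter (\<lambda>y. y < Suc i) [Suc (Suc i)..<Suc n] = []"
    "filter (\<lambda>y. y < i) [Suc (Suc i)..<Suc n] = []"
    by (auto simp: filter_empty_conv)
  ultimately show ?thesis by (simp del: upt_Suc)
qed

lemma inj_on_adj_swap: "inj_on (adj_swap n) {1..<n}"
proof (rule linorder_inj_onI')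
  fix i j assume ij: "i \<in> {1..<n}" "j \<in> {1..<n}" "i < j"
  \<comment> \<open>Index \<open>i - 1\<close> is the place of value \<open>i\<close> in the
    identity; the swap at the larger \<open>j\<close> leaves it alone.\<close>
  have "adj_swap n i ! (i - 1) = Suc i" "adj_swap n j ! (i - 1) = i"
    using ij by (auto simp: adj_swap_def nth_append)
  then show "adj_swap n i \<noteq> adj_swap n j" by auto
qed

text \<open>All \<open>n - 1\<close> adjacent transpositions avoid \<open>B\<close>, having too few
  inversions to contain any of its patterns.\<close>

lemma av_one_ge:
  assumes "\<And>p. p \<in> B \<Longrightarrow> inv_count p > 1"
  shows "n - 1 \<le> av n 1 B"
proof -
  have "avoids (adj_swap n i) p" if "p \<in> B" for i p
    using assms[OF that] inv_count_contains[of "adj_swap n i" p]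
    by (auto simp: avoids_def inv_count_adj_swap)
  then have "adj_swap n ` {1..<n} \<subseteq> {w \<in> perms n. inv_count w = 1 \<and> (\<forall>p\<in>B. avoids w p)}"
    using adj_swap_perms inv_count_adj_swap by auto
  then have "card {1..<n} \<le> av n 1 B"
    unfolding av_def by (intro card_inj_on_le[OF inj_on_adj_swap]) auto
  then show ?thesis by simp
qed

theorem proposition5p1:
  fixes B :: "nat list set"
  assumes "\<And>p. p \<in> B \<Longrightarrow> is_pattern p"
  shows "has_limit_sequence B \<longleftrightarrow> (\<exists>p\<in>B. inv_count p \<le> 1)"
proof
  assume "has_limit_sequence B"
  then obtain m c where mc: "\<And>n. n \<ge> m \<Longrightarrow> av n 1 B = c"
    unfolding has_limit_sequence_def by blast
  show "\<exists>p\<in>B. inv_count p \<le> 1"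
  proof (rule ccontr)
    assume "\<not> ?thesis"
    \<comment> \<open>This size is at least \<open>m\<close>, yet the count is at least
      \<open>m + c + 1 > c\<close>.\<close>
    then have "m + c + 2 - 1 \<le> av (m + c + 2) 1 B"
      by (intro av_one_ge) (meson not_le)
    then show False using mc[of "m + c + 2"] by simp
  qed
next
  assume "\<exists>p\<in>B. inv_count p \<le> 1"
  then obtain p where p: "p \<in> B" "inv_count p \<le> 1" by blast
  then have "distinct p" using assms by (auto simp: is_pattern_def perms_iff)
  then show "has_limit_sequence B" using has_limit_sequenceI p by blast
qed

end
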